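(* For real $C$, the rational stability function $$R(z)=-\frac{(183C-5)z^3+(972C-42)z^2+(1872C-168)z-288}{(z^2-12z+48)\,[9Cz^2-(39C+1)z+6]}$$ is A-stable if and only if $C\in[C_-,C_+]$, where $C_\pm=\frac{25\pm\sqrt{105}}{780}$. For every $C$ in this interval it is L-stable.
   Context: A rational function $R$ is A-stable if it has no poles in the closed left half-plane $\{\operatorname{Re}z\le0\}$ and $|R(z)|\le1$ for all $z$ with $\operatorname{Re}z\le0$. It is L-stable if it is A-stable and $R(z)\to0$ as $|z|\to\infty$ with $\operatorname{Re}z\le 0$. The function $R$ is the stability function of a two-stage two-derivative method: with $a_0=\frac16+\frac72C$, $a_1=\frac23-10C$, $a_2=\frac16+\frac{13}2C$ and $H(z)=\frac{1+z/4+z^2/48}{1-z/4+z^2/48}$, one has $R(z)=\frac{1+a_0z+Cz^2+(a_1z-Cz^2)H(z)}{1-a_2z+\frac32Cz^2}$. *)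

theory Defs
  imports "HOL-Complex_Analysis.Complex_Analysis"
begin

definition rational_function :: "(complex \<Rightarrow> complex) \<Rightarrow> bool" where
  "rational_function R \<longleftrightarrow>
     (\<exists>p q :: complex poly. q \<noteq> 0 \<and> (\<forall>z. R z = poly p z / poly q z))"

(* A zero of the denominator that cancels against the numerator is not a pole in the sense of
   is_pole.  Because x / 0 = 0, the norm bound is vacuous at zeros of the denominator.  At a
   removable one in the closed half-plane, the bound for the continued value follows by continuity
   from the bound at nearby points. *)
definition A_stable :: "(complex \<Rightarrow> complex) \<Rightarrow> bool" where
  "A_stable R \<longleftrightarrow> rational_function R \<and>
     (\<forall>z. Re z \<le> 0 \<longrightarrow> \<not> is_pole R z) \<and>
     (\<forall>z. Re z \<le> 0 \<longrightarrow> norm (R z) \<le> 1)"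

definition L_stable :: "(complex \<Rightarrow> complex) \<Rightarrow> bool" where
  "L_stable R \<longleftrightarrow> A_stable R \<and>
     (R \<longlongrightarrow> 0) (inf at_infinity (principal {z. Re z \<le> 0}))"

definition H :: "complex \<Rightarrow> complex" where
  "H z = (1 + z / 4 + z^2 / 48) / (1 - z / 4 + z^2 / 48)"

definition a0 :: "real \<Rightarrow> real" where "a0 C = 1 / 6 + 7 / 2 * C"
definition a1 :: "real \<Rightarrow> real" where "a1 C = 2 / 3 - 10 * C"
definition a2 :: "real \<Rightarrow> real" where "a2 C = 1 / 6 + 13 / 2 * C"

definition method_stability_fun :: "real \<Rightarrow> complex \<Rightarrow> complex" where
  "method_stability_fun C z =
     (1 + of_real (a0 C) * z + of_real C * z^2
        + (of_real (a1 C) * z - of_real C * z^2) * H z)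
     / (1 - of_real (a2 C) * z + 3 / 2 * of_real C * z^2)"

definition stability_fun :: "real \<Rightarrow> complex \<Rightarrow> complex" where
  "stability_fun C z =
     - ((183 * of_real C - 5) * z^3 + (972 * of_real C - 42) * z^2
          + (1872 * of_real C - 168) * z - 288)
     / ((z^2 - 12 * z + 48) * (9 * of_real C * z^2 - (39 * of_real C + 1) * z + 6))"

definition C_minus :: real where "C_minus = (25 - sqrt 105) / 780"
definition C_plus :: real where "C_plus = (25 + sqrt 105) / 780"

end

theory Submission
  imports Defs
begin

text \<open>
  On the imaginary axis the difference of the squared moduli of the denominator and the numerator
  collapses to $y^6 (81 C^2 y^2 - 24 (1170 C^2 - 75 C + 1))$. Small $y$ therefore forces
  $1170 C^2 - 75 C + 1 \le 0$, which says that $C$ lies between the roots $C_-$ and $C_+$.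
  Conversely this inequality gives $|R| \le 1$ on the axis and $C > 0$; then the poles lie in the
  open right half-plane and $R$ tends to $0$ at infinity, so the maximum modulus principle gives
  $|R| \le 1$ on the left half-plane.
\<close>

text \<open>A Phragmen-Lindelof type bound that needs only the ordinary maximum modulus principle:
  decay at infinity controls f on the arc of a large half-disc, and the axis hypothesis controls it
  on the diameter.\<close>

lemma norm_le_on_left_half_plane:
  fixes f :: "complex \<Rightarrow> complex"
  assumes holo: "f holomorphic_on {z. Re z < 0}"
    and cont: "continuous_on {z. Re z \<le> 0} f"
    and lim: "(f \<longlongrightarrow> 0) (inf at_infinity (principal {z. Re z \<le> 0}))"
    and "B > 0"
    and axis: "\<And>z. Re z = 0 \<Longrightarrow> norm (f z) \<le> B"
    and z: "Re z \<le> 0"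
  shows "norm (f z) \<le> B"
proof (cases "Re z = 0")
  case True
  then show ?thesis by (rule axis)
next
  case False
  have "eventually (\<lambda>w. norm (f w) < B) (inf at_infinity (principal {z. Re z \<le> 0}))"
    using tendstoD[OF lim \<open>B > 0\<close>] by simp
  then obtain b where b: "\<And>w. b \<le> norm w \<Longrightarrow> Re w \<le> 0 \<Longrightarrow> norm (f w) < B"
    by (auto simp: eventually_inf_principal eventually_at_infinity)
  \<comment> \<open>The bound \<open>b\<close> puts the arc where f is already small;
    \<open>norm z + 1\<close> puts z strictly inside the half-disc.\<close>
  define r where "r = max b (norm z + 1)"
  define S where "S = {w. Re w < 0} \<inter> ball 0 r"
  have "open S"
    unfolding S_def by (intro open_Int open_halfspace_Re_lt open_ball)
  have "closed ({w. Re w \<le> 0} \<inter> cball 0 r)"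
    by (intro closed_Int closed_halfspace_Re_le closed_cball)
  then have closure: "closure S \<subseteq> {w. Re w \<le> 0} \<inter> cball 0 r"
    by (rule closure_minimal[rotated]) (auto simp: S_def)
  show ?thesis
  proof (rule maximum_modulus_frontier[where f = f and S = S])
    show "f holomorphic_on interior S"
      using holo by (rule holomorphic_on_subset) (use interior_subset in \<open>auto simp: S_def\<close>)
    show "continuous_on (closure S) f"
      using cont by (rule continuous_on_subset) (use closure in auto)
    show "bounded S"
      unfolding S_def by (rule bounded_subset[OF bounded_ball[of 0 r]]) auto
    show "z \<in> S"
      using z False by (auto simp: S_def r_def)
    fix w assume "w \<in> frontier S"
    then have w: "Re w \<le> 0" "norm w \<le> r" "w \<notin> S"
      using closure \<open>open S\<close> by (auto simp: frontier_def interior_open)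
    show "norm (f w) \<le> B"
    proof (cases "Re w = 0")
      case False
      with w have "norm w = r" by (auto simp: S_def)
      then show ?thesis using b[of w] w by (simp add: r_def)
    qed (rule axis)
  qed
qed

text \<open>If Re z \<le> 0, then 2 a Re z - b < 0, so the imaginary part of the equation makes z
  real. But on the nonpositive reals the quadratic is at least c > 0.\<close>

lemma quadratic_root_right_half_plane:
  fixes a b c :: real and z :: complex
  assumes "a > 0" "b > 0" "c > 0"
    and root: "of_real a * z^2 - of_real b * z + of_real c = 0"
  shows "Re z > 0"
proof (rule ccontr)
  assume "\<not> Re z > 0"
  then have x: "Re z \<le> 0" by simp
  have re: "a * ((Re z)^2 - (Im z)^2) - b * Re z + c = 0"
    and im: "Im z * (2 * a * Re z - b) = 0"
    using arg_cong[OF root, of Re] arg_cong[OF root, of Im]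
    by (simp_all add: power2_eq_square algebra_simps)
  have "a * Re z \<le> 0" "b * Re z \<le> 0"
    using assms x by (simp_all add: mult_nonneg_nonpos)
  with im \<open>b > 0\<close> have "Im z = 0" by auto
  moreover have "a * (Re z)^2 \<ge> 0" using \<open>a > 0\<close> by simp
  ultimately show False using re \<open>b * Re z \<le> 0\<close> \<open>c > 0\<close> by simp
qed

lemma not_is_pole_poly_quotient:
  fixes p q :: "complex poly"
  assumes "poly q z \<noteq> 0"
  shows "\<not> is_pole (\<lambda>w. poly p w / poly q w) z"
proof (rule not_is_pole_holomorphic)
  show "open {w. poly q w \<noteq> 0}"
    by (intro open_Collect_neq continuous_intros)
qed (use assms in \<open>auto intro!: holomorphic_intros\<close>)

definition num_poly :: "real \<Rightarrow> complex poly" where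
  "num_poly C = [:288, of_real (168 - 1872 * C), of_real (42 - 972 * C), of_real (5 - 183 * C):]"

text \<open>Kept as a product so that roots, degree and moduli can be treated one quadratic factor
  at a time.\<close>

definition den_poly :: "real \<Rightarrow> complex poly" where
  "den_poly C = [:48, -12, 1:] * [:6, - of_real (39 * C + 1), of_real (9 * C):]"

lemma poly_den_poly:
  "poly (den_poly C) z =
     (z^2 - 12 * z + 48) * (of_real (9 * C) * z^2 - of_real (39 * C + 1) * z + 6)"
  by (simp add: den_poly_def power2_eq_square algebra_simps)

lemma den_poly_nonzero: "den_poly C \<noteq> 0"
  by (auto simp: den_poly_def)

lemma stability_fun_eq: "stability_fun C z = poly (num_poly C) z / poly (den_poly C) z"
proof -
  have "- ((183 * of_real C - 5) * z^3 + (972 * of_real C - 42) * z^2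
          + (1872 * of_real C - 168) * z - 288) = poly (num_poly C) z"
    by (simp add: num_poly_def power2_eq_square power3_eq_cube algebra_simps)
  then show ?thesis
    by (simp add: stability_fun_def poly_den_poly)
qed

lemma rational_stability_fun: "rational_function (stability_fun C)"
  unfolding rational_function_def using stability_fun_eq den_poly_nonzero by blast

text \<open>The excluded points are the zeros of the denominator of \<open>H\<close>. There x / 0 =
  0 gives \<open>H z\<close> the value 0, and the two formulas need not agree.\<close>

lemma method_stability_fun_eq:
  assumes "z^2 - 12 * z + 48 \<noteq> 0"
  shows "method_stability_fun C z = stability_fun C z"
proof -
  define c where "c = complex_of_real C"
  define P where "P = z^2 - 12 * z + 48"
  define Q where "Q = 9 * c * z^2 - (39 * c + 1) * z + 6"
  define M where "M = 1 + (1 / 6 + 7 / 2 * c) * z + c * z^2"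
  define L where "L = (2 / 3 - 10 * c) * z - c * z^2"
  have P: "P \<noteq> 0" using assms by (simp add: P_def)
  have H: "H z = (z^2 + 12 * z + 48) / P"
  proof -
    have "1 + z / 4 + z^2 / 48 = (z^2 + 12 * z + 48) / 48" "1 - z / 4 + z^2 / 48 = P / 48"
      by (simp_all add: P_def field_simps)
    then show ?thesis using P by (simp only: H_def) (simp add: divide_simps)
  qed
  have Q: "1 - of_real (a2 C) * z + 3 / 2 * of_real C * z^2 = Q / 6"
    by (simp add: a2_def Q_def c_def field_simps)
  have "method_stability_fun C z = (M + L * H z) / (Q / 6)"
    unfolding method_stability_fun_def Q
    by (simp add: M_def L_def a0_def a1_def c_def)
  also have "M + L * H z = (M * P + L * (z^2 + 12 * z + 48)) / P"
    using P by (simp add: H field_simps)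
  \<comment> \<open>This also covers \<open>Q = 0\<close>, where both sides are 0 by x / 0 =
    0.\<close>
  also have "\<dots> / (Q / 6) = 6 * (M * P + L * (z^2 + 12 * z + 48)) / (P * Q)"
    by simp
  also have "6 * (M * P + L * (z^2 + 12 * z + 48)) =
      - ((183 * c - 5) * z^3 + (972 * c - 42) * z^2 + (1872 * c - 168) * z - 288)"
    by (simp add: M_def L_def P_def power2_eq_square power3_eq_cube field_simps)
  also have "\<dots> / (P * Q) = stability_fun C z"
    by (simp add: stability_fun_def P_def Q_def c_def)
  finally show ?thesis .
qed

lemma norm_den_poly_axis:
  "(norm (poly (den_poly C) (Complex 0 y)))^2 =
     (2304 + 48 * y^2 + y^4) * (36 + (1521 * C^2 - 30 * C + 1) * y^2 + 81 * C^2 * y^4)"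
proof -
  have "poly (den_poly C) (Complex 0 y) =
      Complex (48 - y^2) (- 12 * y) * Complex (6 - 9 * C * y^2) (- ((39 * C + 1) * y))"
    unfolding poly_den_poly
    by (rule arg_cong2[where f = "(*)"]) (simp_all add: complex_eq_iff power2_eq_square)
  then show ?thesis
    unfolding cmod_power2 norm_mult power_mult_distrib
    by (simp add: eval_nat_numeral algebra_simps)
qed

text \<open>At z = iy the even powers of z are real and the odd ones imaginary, which splits the
  cubic into its real and imaginary parts.\<close>

lemma norm_num_poly_axis:
  "(norm (poly (num_poly C) (Complex 0 y)))^2 =
     (288 + (972 * C - 42) * y^2)^2 + y^2 * ((1872 * C - 168) - (183 * C - 5) * y^2)^2"
proof -
  have "poly (num_poly C) (Complex 0 y) =
      Complex (288 + (972 * C - 42) * y^2) (- y * ((1872 * C - 168) - (183 * C - 5) * y^2))"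
    by (simp add: num_poly_def complex_eq_iff power2_eq_square algebra_simps)
  then show ?thesis
    by (simp add: cmod_power2 power_mult_distrib)
qed

text \<open>The coefficients of 1, y^2 and y^4 cancel. The y^8 term comes from the denominator
  alone, because the numerator is only a cubic in z.\<close>

lemma norm_diff_axis:
  "(norm (poly (den_poly C) (Complex 0 y)))^2 - (norm (poly (num_poly C) (Complex 0 y)))^2 =
     y^6 * (81 * C^2 * y^2 - 24 * (1170 * C^2 - 75 * C + 1))"
  unfolding norm_den_poly_axis norm_num_poly_axis
  by (simp add: eval_nat_numeral algebra_simps)

text \<open>Holds for every real C, so that also outside the interval a norm bound on the axis
  really compares numerator and denominator instead of holding through x / 0 = 0.\<close>

lemma den_poly_axis_nonzero: "poly (den_poly C) (Complex 0 y) \<noteq> 0"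
proof -
  have "1521 * C^2 - 30 * C + 1 = (39 * C - 5 / 13)^2 + 144 / 169"
    by (simp add: power2_eq_square algebra_simps)
  then have "1521 * C^2 - 30 * C + 1 \<ge> 0" by simp
  then have "(norm (poly (den_poly C) (Complex 0 y)))^2 > 0"
    unfolding norm_den_poly_axis by (intro mult_pos_pos add_pos_nonneg) simp_all
  then show ?thesis by auto
qed

lemma interval_iff: "C \<in> {C_minus..C_plus} \<longleftrightarrow> 1170 * C^2 - 75 * C + 1 \<le> 0"
proof -
  \<comment> \<open>Completing the square, scaled to match the form of \<open>C_minus\<close> and
    \<open>C_plus\<close>; 520 = 780^2 / 1170.\<close>
  have "1170 * C^2 - 75 * C + 1 = ((780 * C - 25)^2 - 105) / 520"
    by (simp add: power2_eq_square algebra_simps)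
  then have "1170 * C^2 - 75 * C + 1 \<le> 0 \<longleftrightarrow> (780 * C - 25)^2 \<le> 105"
    by (simp only:) (simp add: field_simps)
  also have "\<dots> \<longleftrightarrow> \<bar>780 * C - 25\<bar> \<le> sqrt 105"
    using real_sqrt_le_iff[of "(780 * C - 25)^2" 105] by simp
  also have "\<dots> \<longleftrightarrow> C \<in> {C_minus..C_plus}"
    by (auto simp: C_minus_def C_plus_def abs_le_iff field_simps)
  finally show ?thesis by simp
qed

lemma A_stable_imp_interval:
  assumes "A_stable (stability_fun C)"
  shows "C \<in> {C_minus..C_plus}"
proof (rule ccontr)
  define k where "k = 1170 * C^2 - 75 * C + 1"
  \<comment> \<open>Small enough for 81 C^2 y^2 < 24 k, since 81 C^2 < 24 (4 C^2 + 1). The summand 1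
    keeps the divisor positive at C = 0.\<close>
  define y where "y = sqrt (k / (4 * C^2 + 1))"
  let ?n = "norm (poly (num_poly C) (Complex 0 y))"
  let ?d = "norm (poly (den_poly C) (Complex 0 y))"
  assume "C \<notin> {C_minus..C_plus}"
  then have k: "k > 0" unfolding interval_iff k_def by simp
  have pos: "4 * C^2 + 1 > 0" by (intro add_nonneg_pos) simp_all
  have y: "y^2 = k / (4 * C^2 + 1)" "y > 0"
    using k pos by (simp_all add: y_def)
  have "81 * C^2 * k < 24 * (4 * C^2 + 1) * k"
    using k by (intro mult_strict_right_mono) (simp_all add: add_nonneg_pos)
  then have "81 * C^2 * y^2 < 24 * k"
    using pos by (simp add: y field_simps)
  then have "y^6 * (81 * C^2 * y^2 - 24 * k) < 0"
    using \<open>y > 0\<close> by (intro mult_pos_neg) simp_all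
  then have "?d^2 < ?n^2"
    using norm_diff_axis[of C y] by (simp add: k_def)
  then have "?d < ?n" by (rule power2_less_imp_less) simp
  moreover have "norm (stability_fun C (Complex 0 y)) \<le> 1"
    using assms by (simp add: A_stable_def)
  then have "?n \<le> ?d"
    using den_poly_axis_nonzero[of C y]
    by (simp add: stability_fun_eq norm_divide divide_le_eq)
  ultimately show False by simp
qed

lemma interval_imp_L_stable:
  assumes "C \<in> {C_minus..C_plus}"
  shows "L_stable (stability_fun C)"
proof -
  have k: "1170 * C^2 - 75 * C + 1 \<le> 0"
    using assms unfolding interval_iff .
  \<comment> \<open>The inequality \<open>k\<close> gives 75 C \<ge> 1 + 1170 C^2 \<ge> 1.\<close>
  have "C > 0"
  proof -
    have "0 \<le> 1170 * C^2" by simp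
    with k show ?thesis by linarith
  qed
  have den: "poly (den_poly C) z \<noteq> 0" if "Re z \<le> 0" for z
    using that \<open>C > 0\<close> quadratic_root_right_half_plane[of 1 12 48 z]
      quadratic_root_right_half_plane[of "9 * C" "39 * C + 1" 6 z]
    by (auto simp: poly_den_poly)
  \<comment> \<open>Positivity of C keeps the z^4 term of the denominator. For the numerator an
    upper bound is used, because its cubic term vanishes at C = 5/183, inside the interval.\<close>
  have "degree (num_poly C) < degree (den_poly C)"
  proof -
    have "degree (den_poly C) = 4"
      using \<open>C > 0\<close> unfolding den_poly_def by (subst degree_mult_eq) auto
    moreover have "degree (num_poly C) \<le> 3"
      unfolding num_poly_def by (simp add: numeral_eq_Suc)
    ultimately show ?thesis by simp
  qed
  from poly_divide_tendsto_0_at_infinity[OF this]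
  have "(stability_fun C \<longlongrightarrow> 0) at_infinity"
    by (simp add: stability_fun_eq[abs_def])
  then have lim: "(stability_fun C \<longlongrightarrow> 0) (inf at_infinity (principal {z. Re z \<le> 0}))"
    by (rule tendsto_mono[rotated]) simp
  have axis: "norm (stability_fun C z) \<le> 1" if "Re z = 0" for z
  proof -
    define y where "y = Im z"
    have z: "z = Complex 0 y" using that by (simp add: y_def complex_eq_iff)
    have "0 \<le> y^6 * (81 * C^2 * y^2 - 24 * (1170 * C^2 - 75 * C + 1))"
    proof (intro mult_nonneg_nonneg)
      have "24 * (1170 * C^2 - 75 * C + 1) \<le> 0"
        using k by (intro mult_nonneg_nonpos) simp_all
      also have "0 \<le> 81 * C^2 * y^2" by simp
      finally show "0 \<le> 81 * C^2 * y^2 - 24 * (1170 * C^2 - 75 * C + 1)"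
        by (simp only: diff_ge_0_iff_ge)
    qed simp
    then have "(norm (poly (num_poly C) z))^2 \<le> (norm (poly (den_poly C) z))^2"
      unfolding z norm_diff_axis[symmetric] by (simp only: diff_ge_0_iff_ge)
    then have "norm (poly (num_poly C) z) \<le> norm (poly (den_poly C) z)"
      by (rule power2_le_imp_le) simp
    then show ?thesis
      by (simp add: stability_fun_eq norm_divide divide_le_eq)
  qed
  have "norm (stability_fun C z) \<le> 1" if "Re z \<le> 0" for z
  proof (rule norm_le_on_left_half_plane[OF _ _ lim _ axis that])
    show "stability_fun C holomorphic_on {z. Re z < 0}"
      using den by (auto simp: stability_fun_eq[abs_def] intro!: holomorphic_intros)
    show "continuous_on {z. Re z \<le> 0} (stability_fun C)"
      using den by (auto simp: stability_fun_eq[abs_def] intro!: continuous_intros)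
  qed simp_all
  moreover have "\<not> is_pole (stability_fun C) z" if "Re z \<le> 0" for z
    using not_is_pole_poly_quotient[OF den[OF that]] by (simp add: stability_fun_eq[abs_def])
  ultimately show ?thesis
    using lim rational_stability_fun by (simp add: L_stable_def A_stable_def)
qed

theorem theorem2:
  fixes C :: real
  shows "(\<forall>z. z^2 - 12 * z + 48 \<noteq> 0 \<longrightarrow> method_stability_fun C z = stability_fun C z) \<and>
    (A_stable (stability_fun C) \<longleftrightarrow> C \<in> {C_minus..C_plus}) \<and>
    (C \<in> {C_minus..C_plus} \<longrightarrow> L_stable (stability_fun C))"
  \<comment> \<open>Sufficiency in the equivalence comes from L-stability, which contains
    A-stability.\<close>
  using method_stability_fun_eq A_stable_imp_interval interval_imp_L_stable
  unfolding L_stable_def by blast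

end
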